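(* Let $n\ge 1$ and let $w$ be a Kreweras word of length $3n$. Then $\mathrm{pro}^{3n}(w)$ is the word obtained from $w$ by replacing every $\mathsf{B}$ by $\mathsf{C}$ and every $\mathsf{C}$ by $\mathsf{B}$. In particular, $\mathrm{pro}^{6n}(w)=w$.
   Context: A Kreweras word of length $3n$ is a word $w=(w_1,\dots,w_{3n})$ in the letters $\mathsf{A},\mathsf{B},\mathsf{C}$ containing exactly $n$ copies of each letter, such that every prefix $(w_1,\dots,w_k)$ contains at least as many $\mathsf{A}$'s as $\mathsf{B}$'s and at least as many $\mathsf{A}$'s as $\mathsf{C}$'s. For such $w$, let $\iota(w)$ be the smallest index $\iota\ge 1$ such that the prefix $(w_1,\dots,w_\iota)$ contains the same number of $\mathsf{A}$'s as $\mathsf{B}$'s or the same number of $\mathsf{A}$'s as $\mathsf{C}$'s. The promotion of $w$ is $\mathrm{pro}(w)=(w_2,w_3,\dots,w_{\iota(w)-1},\mathsf{A},w_{\iota(w)+1},\dots,w_{3n},w_{\iota(w)})$; it is again a Kreweras word, and $\mathrm{pro}$ is a bijection on the set of Kreweras words of length $3n$. $\mathrm{pro}^k$ denotes the $k$-fold iterate. *)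

theory Defs
  imports Main
begin

datatype letter = A | B | C

definition kreweras_word :: "nat \<Rightarrow> letter list \<Rightarrow> bool" where
  "kreweras_word n w \<longleftrightarrow>
     length w = 3 * n \<and>
     count_list w A = n \<and> count_list w B = n \<and> count_list w C = n \<and>
     (\<forall>k \<le> 3 * n.
        count_list (take k w) B \<le> count_list (take k w) A \<and>
        count_list (take k w) C \<le> count_list (take k w) A)"

text \<open>The index is 1-based: it is the length of the shortest nonempty prefix with the required
  property. For a Kreweras word with \<open>n \<ge> 1\<close> the whole word has the property, so the least
  element exists and is at most \<open>3 * n\<close>; it is at least 2, as the first letter is \<open>A\<close>.\<close>

definition iota :: "letter list \<Rightarrow> nat" where
  "iota w = (LEAST i. 1 \<le> i \<and>
     (count_list (take i w) A = count_list (take i w) B \<or>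
      count_list (take i w) A = count_list (take i w) C))"

text \<open>In 1-based indexing, \<open>take (iota w - 2) (drop 1 w)\<close> lists the letters at positions
  \<open>2, \<dots>, iota w - 1\<close>, and \<open>w ! (iota w - 1)\<close> is the letter at position \<open>iota w\<close>.\<close>

definition pro :: "letter list \<Rightarrow> letter list" where
  "pro w = take (iota w - 2) (drop 1 w) @ [A] @ drop (iota w) w @ [w ! (iota w - 1)]"

fun swap_BC :: "letter \<Rightarrow> letter" where
  "swap_BC A = A"
| "swap_BC B = C"
| "swap_BC C = B"

end

theory Submission
  imports Defs
begin

text \<open>
  Keep absolute positions: after \<open>t\<close> promotions of a word of length \<open>N\<close> the letters
  occupy the positions \<open>t, \<dots>, t + N - 1\<close>, and one promotion turns the letter at the
  first return \<open>p\<^sub>t\<close> into an \<open>A\<close>, drops position \<open>t\<close> and copies the old letter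
  to position \<open>t + N\<close>. Match the \<open>A\<close>s with the \<open>B\<close>s, and the \<open>A\<close>s with the
  \<open>C\<close>s, as parentheses; draw each pair as an arc. If \<open>X\<close> is the letter at \<open>p\<^sub>t\<close> and
  \<open>Y\<close> the other one of \<open>B, C\<close>, then promotion moves the \<open>X\<close>-arc \<open>(t, p\<^sub>t)\<close> to
  \<open>(p\<^sub>t, t + N)\<close>, and the \<open>Y\<close>-arcs \<open>(u\<^sub>k, c\<^sub>k)\<close> over \<open>p\<^sub>t\<close>, with
  \<open>t = u\<^sub>0 < \<dots> < u\<^sub>m < p\<^sub>t\<close>, become \<open>(u\<^bsub>k+1\<^esub>, c\<^sub>k)\<close> with
  \<open>u\<^bsub>m+1\<^esub> = p\<^sub>t\<close>; all other arcs stay.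

  Walking along the arcs and turning at crossings by fixed rules of the road (the trips of Hopkins
  and Rubey) relates positions to positions. This relation is unchanged by a promotion, except that
  \<open>t\<close> is renamed to \<open>t + N\<close>, and \<open>p\<^sub>t\<close> is the only position whose trip ends at
  \<open>t\<close>. Hence \<open>p\<^bsub>t+N\<^esub> = p\<^sub>t + N\<close>. The colour of an entry \<open>B\<close> or \<open>C\<close>, or of the
  shorter arc at an \<open>A\<close>, only changes at \<open>p\<^sub>t\<close>, where it flips; in \<open>N\<close> steps every
  position is hit once, so the letter at \<open>p\<^bsub>t+N\<^esub>\<close> is the swap of the letter at \<open>p\<^sub>t\<close>.
  The first returns and their letters determine the word.
\<close>

subsection \<open>Trips\<close>

definition closes_from :: "(nat \<Rightarrow> nat \<Rightarrow> bool) \<Rightarrow> nat \<Rightarrow> nat \<Rightarrow> bool" where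
  "closes_from Q l x \<longleftrightarrow> (\<exists>a\<le>l. Q a x)"

definition opens_beyond :: "(nat \<Rightarrow> nat \<Rightarrow> bool) \<Rightarrow> nat \<Rightarrow> nat \<Rightarrow> bool" where
  "opens_beyond P r x \<longleftrightarrow> (\<exists>b>r. P x b)"

text \<open>
  A trip is a zigzag through a shrinking interval \<open>(l, r)\<close>. In phase L it runs leftwards along a
  \<open>P\<close>-arc starting at \<open>l\<close> and turns right onto the first \<open>Q\<close>-arc that starts at or before
  \<open>l\<close> and ends before \<open>r\<close>; in phase R it runs rightwards along a \<open>Q\<close>-arc ending at
  \<open>r\<close> and turns left onto the first \<open>P\<close>-arc that starts after \<open>l\<close> and ends beyond
  \<open>r\<close>. All other crossings are passed straight.
\<close>

inductive tripL tripR :: "(nat \<Rightarrow> nat \<Rightarrow> bool) \<Rightarrow> (nat \<Rightarrow> nat \<Rightarrow> bool) \<Rightarrow> nat \<Rightarrow> nat \<Rightarrow> nat \<Rightarrow> bool"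
  for P Q where
  L_stop: "(\<And>x. l < x \<Longrightarrow> x < r \<Longrightarrow> \<not> closes_from Q l x) \<Longrightarrow> tripL P Q l r l"
| L_turn: "l < c \<Longrightarrow> c < r \<Longrightarrow> closes_from Q l c \<Longrightarrow> (\<And>x. c < x \<Longrightarrow> x < r \<Longrightarrow> \<not> closes_from Q l x) \<Longrightarrow>
    tripR P Q l c k \<Longrightarrow> tripL P Q l r k"
| R_stop: "(\<And>x. l < x \<Longrightarrow> x < r \<Longrightarrow> \<not> opens_beyond P r x) \<Longrightarrow> tripR P Q l r r"
| R_turn: "l < u \<Longrightarrow> u < r \<Longrightarrow> opens_beyond P r u \<Longrightarrow> (\<And>x. l < x \<Longrightarrow> x < u \<Longrightarrow> \<not> opens_beyond P r x) \<Longrightarrow>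
    tripL P Q u r k \<Longrightarrow> tripR P Q l r k"

definition trip_via :: "(nat \<Rightarrow> nat \<Rightarrow> bool) \<Rightarrow> (nat \<Rightarrow> nat \<Rightarrow> bool) \<Rightarrow> nat \<Rightarrow> nat \<Rightarrow> bool" where
  "trip_via P Q j k \<longleftrightarrow> (\<exists>a. P a j \<and> tripL P Q a j k) \<or> (\<exists>b c. P j b \<and> Q j c \<and> b < c \<and> tripR P Q j c k)"

definition trip :: "(nat \<Rightarrow> nat \<Rightarrow> bool) \<Rightarrow> (nat \<Rightarrow> nat \<Rightarrow> bool) \<Rightarrow> nat \<Rightarrow> nat \<Rightarrow> bool" where
  "trip P Q j k \<longleftrightarrow> trip_via P Q j k \<or> trip_via Q P j k"

text \<open>Each turn moves one boundary strictly inwards. The asymmetry between the phases decides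
  later which trips can end at the leftmost position \<open>z\<close>.\<close>

lemma trip_bounds:
  "tripL P Q l r k \<Longrightarrow> l < r \<Longrightarrow> l \<le> k \<and> k < r"
  "tripR P Q l r k \<Longrightarrow> l < r \<Longrightarrow> l < k \<and> k \<le> r"
  by (induction rule: tripL_tripR.inducts) auto

text \<open>A trip tests only positions inside its current interval, and the intervals shrink, so
  the arcs matter only through the two predicates evaluated there.\<close>

lemma trip_cong:
  assumes "\<And>l r x. lo < l \<Longrightarrow> r < hi \<Longrightarrow> l < x \<Longrightarrow> x < r \<Longrightarrow> closes_from Q' l x = closes_from Q l x"
    and "\<And>l r x. lo < l \<Longrightarrow> r < hi \<Longrightarrow> l < x \<Longrightarrow> x < r \<Longrightarrow> opens_beyond P' r x = opens_beyond P r x"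
  shows "tripL P Q l r k \<Longrightarrow> lo < l \<Longrightarrow> r < hi \<Longrightarrow> tripL P' Q' l r k"
    and "tripR P Q l r k \<Longrightarrow> lo < l \<Longrightarrow> r < hi \<Longrightarrow> tripR P' Q' l r k"
proof (induction rule: tripL_tripR.inducts)
  case (L_stop l r)
  then show ?case by (intro tripL_tripR.L_stop) (use assms in auto)
next
  case (L_turn l c r k)
  show ?case by (rule tripL_tripR.L_turn[of l c r]) (use L_turn assms(1)[of l r] in auto)
next
  case (R_stop l r)
  then show ?case by (intro tripL_tripR.R_stop) (use assms in auto)
next
  case (R_turn l u r k)
  show ?case by (rule tripL_tripR.R_turn[of l u r]) (use R_turn assms(2)[of l r] in auto)
qed

text \<open>
  The \<open>P\<close>s are the arcs before, the \<open>Q\<close>s the arcs after a promotion of the window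
  \<open>{z..<e}\<close> with first return \<open>p\<close>.
\<close>

locale rotation =
  fixes z e p m :: nat and u c :: "nat \<Rightarrow> nat"
    and PX PY QX QY :: "nat \<Rightarrow> nat \<Rightarrow> bool"
  assumes zp: "z < p" and pe: "p < e"
    and PXz: "PX z p"
    and PX_cases: "\<And>a b. PX a b \<Longrightarrow> (a = z \<and> b = p) \<or> (z < a \<and> a < b \<and> b < p) \<or> (p < a \<and> a < b \<and> b < e)"
    and QX_iff: "\<And>a b. QX a b \<longleftrightarrow> (a = p \<and> b = e) \<or> (PX a b \<and> a \<noteq> z)"
    and u_0: "u 0 = z" and u_top: "u (Suc m) = p"
    and u_mono: "\<And>i j. i < j \<Longrightarrow> j \<le> Suc m \<Longrightarrow> u i < u j"
    and c_anti: "\<And>i j. i < j \<Longrightarrow> j \<le> m \<Longrightarrow> c j < c i"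
    and c_bounds: "\<And>k. k \<le> m \<Longrightarrow> p < c k \<and> c k < e"
    and PY_uc: "\<And>k. k \<le> m \<Longrightarrow> PY (u k) (c k)"
    and PY_cases: "\<And>a b. PY a b \<Longrightarrow> (z < a \<and> a < b \<and> b < p) \<or> (p < a \<and> a < b \<and> b < e) \<or>
      (\<exists>k\<le>m. a = u k \<and> b = c k)"
    and QY_iff: "\<And>a b. QY a b \<longleftrightarrow> (PY a b \<and> (b < p \<or> p < a)) \<or> (\<exists>k\<le>m. a = u (Suc k) \<and> b = c k)"
begin

lemma u_less_p: "k \<le> m \<Longrightarrow> u k < p" using u_mono[of k "Suc m"] u_top by simp
lemma u_le_p: "k \<le> Suc m \<Longrightarrow> u k \<le> p" using u_less_p u_top by (metis le_SucE less_imp_le order_refl)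
lemma z_le_u: "k \<le> Suc m \<Longrightarrow> z \<le> u k" using u_mono[of 0 k] u_0 by (cases k) (auto)
lemma z_less_u: "0 < k \<Longrightarrow> k \<le> Suc m \<Longrightarrow> z < u k" using u_mono[of 0 k] u_0 by auto

lemma QY_uc: "k \<le> m \<Longrightarrow> QY (u (Suc k)) (c k)" by (auto simp: QY_iff)
lemma QX_pe: "QX p e" by (simp add: QX_iff)

section \<open>Ends and starts of arcs before and after a promotion\<close>

lemma closes_QX: "l < x \<Longrightarrow> x \<noteq> p \<Longrightarrow> x < e \<Longrightarrow> closes_from QX l x = closes_from PX l x"
  unfolding closes_from_def QX_iff using PX_cases zp pe by fastforce

lemma opens_QX: "x \<noteq> p \<Longrightarrow> z < x \<Longrightarrow> opens_beyond QX r x = opens_beyond PX r x"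
  unfolding opens_beyond_def QX_iff by auto

lemma closes_QY_left: "x < p \<Longrightarrow> closes_from QY l x = closes_from PY l x"
  unfolding closes_from_def QY_iff using c_bounds by fastforce

text \<open>An arc over \<open>p\<close> keeps its end; its start moves from \<open>u k\<close> to
  \<open>u (Suc k)\<close>, which is at most \<open>p\<close> and so still before
  \<open>l\<close>.\<close>

lemma closes_QY_right: assumes "p < l" shows "closes_from QY l x = closes_from PY l x"
proof
  assume "closes_from QY l x"
  then show "closes_from PY l x"
    unfolding closes_from_def QY_iff using assms PY_uc u_less_p by (meson leD le_trans less_imp_le linorder_not_less)
next
  assume "closes_from PY l x"
  then obtain a where a: "a \<le> l" "PY a x" by (auto simp: closes_from_def)
  from PY_cases[OF a(2)] show "closes_from QY l x"
  proof (elim disjE exE conjE)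
    fix k assume "k \<le> m" "a = u k" "x = c k"
    then have "QY (u (Suc k)) x" "u (Suc k) \<le> l" using QY_uc u_le_p[of "Suc k"] assms by auto
    then show ?thesis by (auto simp: closes_from_def)
  qed (use a in \<open>auto simp: closes_from_def QY_iff\<close>)
qed

text \<open>Each \<open>u k\<close> with \<open>0 < k \<le> m\<close> starts an arc over
  \<open>p\<close> before and after: its end changes from \<open>c k\<close> to
  \<open>c (k - 1)\<close>, and both lie beyond \<open>r\<close>.\<close>

lemma opens_QY_left: assumes "r < p" "z < x" "x < p" shows "opens_beyond QY r x = opens_beyond PY r x"
proof
  assume "opens_beyond QY r x"
  then obtain b where b: "b > r" "QY x b" by (auto simp: opens_beyond_def)
  then consider "PY x b" | k where "k \<le> m" "x = u (Suc k)" by (auto simp: QY_iff)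
  then show "opens_beyond PY r x"
  proof cases
    case 1 then show ?thesis using b by (auto simp: opens_beyond_def)
  next
    case (2 k)
    then have "k \<noteq> m" using u_top assms by auto
    with 2 have "PY x (c (Suc k))" "c (Suc k) > r" using PY_uc[of "Suc k"] c_bounds[of "Suc k"] assms by auto
    then show ?thesis by (auto simp: opens_beyond_def)
  qed
next
  assume "opens_beyond PY r x"
  then obtain b where b: "b > r" "PY x b" by (auto simp: opens_beyond_def)
  from PY_cases[OF b(2)] show "opens_beyond QY r x"
  proof (elim disjE exE conjE)
    fix k assume k: "k \<le> m" "x = u k" "b = c k"
    then have "k \<noteq> 0" using u_0 assms by (metis less_irrefl)
    then obtain i where "k = Suc i" by (cases k) auto
    then have "QY x (c i)" "c i > r" using k QY_uc[of i] c_bounds[of i] assms by auto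
    then show ?thesis by (auto simp: opens_beyond_def)
  qed (use b assms in \<open>auto simp: opens_beyond_def QY_iff\<close>)
qed

lemma opens_QY_right: "p < x \<Longrightarrow> opens_beyond QY r x = opens_beyond PY r x"
  unfolding opens_beyond_def QY_iff using u_le_p by (metis Suc_le_mono leD)

section \<open>Trips that stay on one side of \<open>p\<close>\<close>

lemma tripL_XY_left: "tripL PX PY l r k \<Longrightarrow> z < l \<Longrightarrow> r < p \<Longrightarrow> tripL QX QY l r k"
  by (rule trip_cong(1)[where lo = z and hi = p]) (auto simp: closes_QY_left opens_QX)
lemma tripR_XY_left: "tripR PX PY l r k \<Longrightarrow> z < l \<Longrightarrow> r < p \<Longrightarrow> tripR QX QY l r k"
  by (rule trip_cong(2)[where lo = z and hi = p]) (auto simp: closes_QY_left opens_QX)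
lemma tripL_YX_left: "tripL PY PX l r k \<Longrightarrow> z < l \<Longrightarrow> r < p \<Longrightarrow> tripL QY QX l r k"
  by (rule trip_cong(1)[where lo = z and hi = p]) (use pe in \<open>auto simp: closes_QX opens_QY_left\<close>)
lemma tripR_YX_left: "tripR PY PX l r k \<Longrightarrow> z < l \<Longrightarrow> r < p \<Longrightarrow> tripR QY QX l r k"
  by (rule trip_cong(2)[where lo = z and hi = p]) (use pe in \<open>auto simp: closes_QX opens_QY_left\<close>)
lemma tripL_XY_right: "tripL PX PY l r k \<Longrightarrow> p < l \<Longrightarrow> r < e \<Longrightarrow> tripL QX QY l r k"
  by (rule trip_cong(1)[where lo = p and hi = e]) (use zp in \<open>auto simp: closes_QY_right opens_QX\<close>)
lemma tripR_XY_right: "tripR PX PY l r k \<Longrightarrow> p < l \<Longrightarrow> r < e \<Longrightarrow> tripR QX QY l r k"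
  by (rule trip_cong(2)[where lo = p and hi = e]) (use zp in \<open>auto simp: closes_QY_right opens_QX\<close>)
lemma tripL_YX_right: "tripL PY PX l r k \<Longrightarrow> p < l \<Longrightarrow> r < e \<Longrightarrow> tripL QY QX l r k"
  by (rule trip_cong(1)[where lo = p and hi = e]) (auto simp: closes_QX opens_QY_right)
lemma tripR_YX_right: "tripR PY PX l r k \<Longrightarrow> p < l \<Longrightarrow> r < e \<Longrightarrow> tripR QY QX l r k"
  by (rule trip_cong(2)[where lo = p and hi = e]) (auto simp: closes_QX opens_QY_right)

section \<open>The trip that ends at \<open>z\<close>\<close>

lemma not_closes_PY_z: "x < p \<Longrightarrow> \<not> closes_from PY z x"
  unfolding closes_from_def using PY_cases zp c_bounds by fastforce

lemma trip_p_z: "trip PX PY p z"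
  unfolding trip_def trip_via_def using PXz not_closes_PY_z by (blast intro: L_stop)

lemma tripL_z_p: assumes "tripL PX PY z p k" shows "k = z"
  using assms by cases (auto simp: not_closes_PY_z)

lemma arc_X_shorter_at_z: "PX z b \<Longrightarrow> PY z c' \<Longrightarrow> b < c'"
  using PX_cases[of z b] PY_cases[of z c'] zp c_bounds by fastforce

text \<open>As \<open>z\<close> is leftmost, only a phase L along an arc starting at
  \<open>z\<close> can end there. On the \<open>PY\<close>-arc from \<open>z\<close> the end
  \<open>p\<close> of the arc \<open>(z, p)\<close> forces a turn, and after it the left boundary
  \<open>z\<close> is out of reach. The arc \<open>(z, p)\<close> remains.\<close>

lemma trip_z_unique: assumes "trip PX PY j z" shows "j = p"
proof -
  have less: "a < b" if "PX a b \<or> PY a b" for a b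
    using that PX_cases[of a b] PY_cases[of a b] zp c_bounds u_less_p by (metis less_trans)
  have ge: "z \<le> a" if "PX a b \<or> PY a b" for a b
    using that PX_cases[of a b] PY_cases[of a b] zp z_le_u by (metis le_SucI less_imp_le less_trans order_refl)
  consider (1) a where "PX a j" "tripL PX PY a j z" | (2) a where "PY a j" "tripL PY PX a j z"
    | (3) b where "PX j b" "tripR PX PY j b z \<or> tripR PY PX j b z"
    | (4) b where "PY j b" "tripR PX PY j b z \<or> tripR PY PX j b z"
    using assms unfolding trip_def trip_via_def by blast
  then show ?thesis
  proof cases
    case 1
    then have "a = z" using less ge trip_bounds(1) by (metis le_antisym)
    then show ?thesis using 1 PX_cases zp by fastforce
  next
    case 2
    then have "a = z" using less ge trip_bounds(1) by (metis le_antisym)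
    then have "p < j" using 2 PY_cases[of z j] zp c_bounds by auto
    from 2(2) show ?thesis
    proof cases
      case L_stop
      then show ?thesis using PXz zp \<open>p < j\<close> \<open>a = z\<close> by (auto simp: closes_from_def)
    next
      case (L_turn x)
      then show ?thesis using trip_bounds(2) \<open>a = z\<close> by blast
    qed
  next
    case 3
    then show ?thesis using less ge trip_bounds(2) by (metis leD)
  next
    case 4
    then show ?thesis using less ge trip_bounds(2) by (metis leD)
  qed
qed

section \<open>Trips that cross \<open>p\<close>\<close>

text \<open>An X-arc ending beyond \<open>c i\<close> starts right of \<open>p\<close> before the
  promotion, so the trip meets no turn up to \<open>p\<close>. The new arc \<open>(p, e)\<close>
  starts at the boundary \<open>p\<close> itself and is not tested either.\<close>

lemma tripR_XY_straddle:
  assumes "tripR PX PY l (c i) k" "i \<le> m" "z \<le> l" "l \<le> p"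
  shows "tripR QX QY p (c i) k"
  using assms(1)
proof cases
  case R_stop
  show ?thesis unfolding \<open>k = c i\<close>
    by (rule tripL_tripR.R_stop) (use R_stop opens_QX zp assms in auto)
next
  case (R_turn v)
  then obtain b where b: "b > c i" "PX v b" by (auto simp: opens_beyond_def)
  have v: "p < v" using PX_cases[OF b(2)] b(1) c_bounds[OF assms(2)] by auto
  show ?thesis
  proof (rule tripL_tripR.R_turn[of p v])
    show "tripL QX QY v (c i) k" using R_turn v tripL_XY_right c_bounds assms by auto
  qed (use v R_turn opens_QX zp assms in auto)
qed

text \<open>The new trip makes a detour: it turns left onto the new arc \<open>(p, e)\<close> at
  \<open>p\<close>, then right at \<open>c (Suc i)\<close>, the last end before \<open>c i\<close>
  of a Y-arc starting at or before \<open>p\<close>. There it joins the old trip.\<close>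

lemma tripR_from_u:
  assumes "tripR PX PY (u (Suc i)) (c (Suc i)) k" "Suc i \<le> m"
  shows "tripR QX QY (u (Suc i)) (c i) k"
proof (rule R_turn[of _ p])
  have ci: "p < c i" "c i < e" "p < c (Suc i)" "c (Suc i) < c i"
    using c_bounds[of i] c_bounds[of "Suc i"] c_anti[of i "Suc i"] assms by auto
  show "u (Suc i) < p" using u_less_p assms by auto
  show "p < c i" by fact
  show "opens_beyond QX (c i) p" using QX_pe ci by (auto simp: opens_beyond_def)
  show "\<not> opens_beyond QX (c i) x" if "u (Suc i) < x" "x < p" for x
    unfolding opens_beyond_def QX_iff using that ci PX_cases[of x] zp by fastforce
  show "tripL QX QY p (c i) k"
  proof (rule L_turn[of _ "c (Suc i)"])
    show "closes_from QY p (c (Suc i))" using QY_uc[of "Suc i"] u_le_p[of "Suc (Suc i)"] assms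
      by (auto simp: closes_from_def)
    show "\<not> closes_from QY p x" if x: "c (Suc i) < x" "x < c i" for x
    proof
      assume "closes_from QY p x"
      then obtain k where k: "k \<le> m" "x = c k" unfolding closes_from_def QY_iff using x ci by auto
      have "k < Suc i" using x k c_anti[of "Suc i" k] by (metis less_asym linorder_neqE_nat)
      moreover have "i < k" using x k c_anti[of k i] assms by (metis Suc_leD less_asym linorder_neqE_nat)
      ultimately show False by simp
    qed
    show "tripR QX QY p (c (Suc i)) k"
      by (rule tripR_XY_straddle[OF assms]) (use z_le_u u_le_p assms in auto)
  qed (use ci in auto)
qed

text \<open>Here the old trip makes the detour: it turns at \<open>p\<close> onto
  \<open>(z, p)\<close>, then onto the Y-arc from \<open>u (Suc i)\<close>, or it stops at
  \<open>p = u (Suc m)\<close> if \<open>i = m\<close>. The new trip runs along the arc from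
  \<open>u (Suc i)\<close> directly, since no X-arc starting left of \<open>p\<close> ends at or
  beyond \<open>p\<close> any more.\<close>

lemma tripL_from_c:
  assumes "tripL PY PX (u i) (c i) k" "i \<le> m"
  shows "tripL QY QX (u (Suc i)) (c i) k"
proof -
  have ci: "p < c i" "c i < e" and ui: "z \<le> u i" "u i < p"
    using c_bounds[of i] u_less_p[of i] z_le_u[of i] assms by auto
  have cl_p: "closes_from PX (u i) p" using PXz ui by (auto simp: closes_from_def)
  have cl_gt: "\<not> closes_from PX l x" if "l < p" "p < x" for l x
    unfolding closes_from_def using that PX_cases[of _ x] by fastforce
  have cl_Qp: "\<not> closes_from QX l p" for l
    unfolding closes_from_def QX_iff using PX_cases[of _ p] pe by fastforce
  have "tripR PY PX (u i) p k"
    using assms(1)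
  proof cases
    case L_stop
    then show ?thesis using cl_p ui ci by auto
  next
    case (L_turn x)
    then have "x = p" using cl_p cl_gt[of "u i" x] ui ci by (metis linorder_neqE_nat)
    then show ?thesis using L_turn by simp
  qed
  then show ?thesis
  proof cases
    case R_stop
    have "i = m"
    proof (rule ccontr)
      assume "i \<noteq> m"
      then have i: "Suc i \<le> m" using assms by simp
      have "opens_beyond PY p (u (Suc i))" using PY_uc[OF i] c_bounds[OF i] by (auto simp: opens_beyond_def)
      then show False using R_stop u_mono[of i "Suc i"] u_less_p[OF i] i by auto
    qed
    moreover have "tripL QY QX p (c m) p"
    proof (rule L_stop)
      fix x assume "p < x" "x < c m"
      then show "\<not> closes_from QX p x"
        using ci \<open>i = m\<close> unfolding closes_from_def QX_iff using PX_cases[of _ x] by fastforce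
    qed
    ultimately show ?thesis using R_stop u_top by simp
  next
    case (R_turn v)
    then obtain b where b: "b > p" "PY v b" by (auto simp: opens_beyond_def)
    then obtain i' where i': "i' \<le> m" "v = u i'" using PY_cases[OF b(2)] \<open>v < p\<close> by auto
    have "i < i'" using \<open>u i < v\<close> i' u_mono[of i' i] assms by (metis le_SucI less_asym linorder_neqE_nat)
    then have i: "Suc i \<le> m" using i' by simp
    have "opens_beyond PY p (u (Suc i))" using PY_uc[OF i] c_bounds[OF i] by (auto simp: opens_beyond_def)
    then have "\<not> u (Suc i) < v" using R_turn u_mono[of i "Suc i"] i by auto
    then have "\<not> Suc i < i'" using i' u_mono[of "Suc i" i'] by auto
    with \<open>i < i'\<close> have v: "v = u (Suc i)" using i' by (metis Suc_lessI)
    have zv: "z < v" using z_less_u[of "Suc i"] i v by auto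
    have eq: "closes_from QX v x = (x < p \<and> closes_from PX v x)" if "v < x" "x < c i" for x
      using that closes_QX[of v x] cl_Qp cl_gt[of v x] ci \<open>v < p\<close> by (metis less_trans linorder_neqE_nat)
    from \<open>tripL PY PX v p k\<close> have "tripL QY QX v (c i) k"
    proof cases
      case L_stop
      show ?thesis unfolding \<open>k = v\<close> by (rule tripL_tripR.L_stop) (use L_stop eq in auto)
    next
      case (L_turn x)
      show ?thesis
      proof (rule tripL_tripR.L_turn[of v x])
        show "tripR QY QX v x k" using L_turn zv tripR_YX_left by blast
      qed (use L_turn ci eq in auto)
    qed
    then show ?thesis using v by simp
  qed
qed

section \<open>Invariance of the trip relation\<close>

definition rot :: "nat \<Rightarrow> nat" where "rot j = (if j = z then e else j)"

lemma trip_via_XY_rot: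
  assumes "trip_via PX PY j k"
  shows "trip QX QY (rot j) (rot k)"
  using assms unfolding trip_via_def
proof (elim disjE exE conjE)
  fix a assume a: "PX a j" "tripL PX PY a j k"
  from PX_cases[OF a(1)] show ?thesis
  proof (elim disjE conjE)
    \<comment> \<open>After the promotion \<open>p\<close> starts the arcs \<open>(p, c m)\<close>
      and \<open>(p, e)\<close>. Its trip follows the longer one to \<open>e = rot z\<close>, as no
      Y-arc ends beyond \<open>e\<close>.\<close>
    assume [simp]: "a = z" "j = p"
    have "k = z" using a(2) tripL_z_p by simp
    moreover have "tripR QY QX p e e"
    proof (rule R_stop)
      fix x show "\<not> opens_beyond QY e x" unfolding opens_beyond_def QY_iff
        using PY_cases[of x] c_bounds pe by fastforce
    qed
    moreover have "QY p (c m)" "c m < e" using QY_uc[of m] u_top c_bounds[of m] by auto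
    ultimately show ?thesis using zp QX_pe unfolding trip_def trip_via_def rot_def by auto
  next
    assume "z < a" "a < j" "j < p"
    then show ?thesis using a tripL_XY_left[OF a(2)] trip_bounds(1)[OF a(2)]
      unfolding trip_def trip_via_def rot_def QX_iff by auto
  next
    assume "p < a" "a < j" "j < e"
    then show ?thesis using a tripL_XY_right[OF a(2)] trip_bounds(1)[OF a(2)] zp
      unfolding trip_def trip_via_def rot_def QX_iff by auto
  qed
next
  fix b d assume a: "PX j b" "PY j d" "b < d" "tripR PX PY j d k"
  consider (z) "j = z" "d = c 0" | (l) "z < j" "j < d" "d < p" | (r) "p < j" "j < d" "d < e"
    | (u) i where "Suc i \<le> m" "j = u (Suc i)" "d = c (Suc i)" "b < p" "z < j"
    using PY_cases[OF a(2)]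
  proof (elim disjE conjE exE)
    fix i assume i: "i \<le> m" "j = u i" "d = c i"
    have "j < p" using i u_less_p by auto
    show thesis
    proof (cases i)
      case 0
      then show thesis using i u_0 that(1) by simp
    next
      case (Suc i')
      then have "z < j" using i z_less_u[of i] by auto
      moreover have "b < p" using PX_cases[OF a(1)] \<open>z < j\<close> \<open>j < p\<close> by auto
      ultimately show thesis using that(4)[of i'] i Suc by auto
    qed
  qed (use that in auto)
  then show ?thesis
  proof cases
    \<comment> \<open>The old trip runs right along \<open>(z, c 0)\<close>. The new one starts at
      \<open>e = rot z\<close>, runs left along \<open>(p, e)\<close> and turns at
      \<open>c 0\<close>, the last end of a Y-arc starting at or before \<open>p\<close>.\<close>
    case z
    have c0: "p < c 0" "c 0 < e" using c_bounds by auto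
    have "tripL QX QY p e k"
    proof (rule L_turn[of _ "c 0"])
      show "closes_from QY p (c 0)" using QY_uc[of 0] u_le_p[of "Suc 0"] by (auto simp: closes_from_def)
      show "\<not> closes_from QY p x" if x: "c 0 < x" "x < e" for x
      proof
        assume "closes_from QY p x"
        then obtain k where k: "k \<le> m" "x = c k" unfolding closes_from_def QY_iff using x c0 by auto
        then show False using x c_anti[of 0 k] by (cases k) auto
      qed
      show "tripR QX QY p (c 0) k" by (rule tripR_XY_straddle[of z]) (use a z zp in auto)
    qed (use c0 in auto)
    moreover have "k \<noteq> z" using trip_bounds(2)[OF a(4)] z c0 zp by auto
    ultimately show ?thesis using z QX_pe unfolding trip_def trip_via_def rot_def by auto
  next
    case l
    then show ?thesis using a tripR_XY_left[OF a(4)] trip_bounds(2)[OF a(4)]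
      unfolding trip_def trip_via_def rot_def QX_iff QY_iff by auto
  next
    case r
    then show ?thesis using a tripR_XY_right[OF a(4)] trip_bounds(2)[OF a(4)] zp
      unfolding trip_def trip_via_def rot_def QX_iff QY_iff by auto
  next
    case (u i)
    have "j < d" using u u_less_p[of "Suc i"] c_bounds[of "Suc i"] by auto
    then have "k \<noteq> z" using trip_bounds(2)[OF a(4)] u by auto
    moreover have "tripR QX QY j (c i) k" using tripR_from_u a u by simp
    moreover have "QX j b" "QY j (c i)" "b < c i" using a u QX_iff QY_uc[of i] c_bounds[of i] by auto
    ultimately show ?thesis using u unfolding trip_def trip_via_def rot_def by auto
  qed
qed

lemma trip_via_YX_rot:
  assumes "trip_via PY PX j k"
  shows "trip QX QY (rot j) (rot k)"
  using assms unfolding trip_via_def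
proof (elim disjE exE conjE)
  fix a assume a: "PY a j" "tripL PY PX a j k"
  from PY_cases[OF a(1)] show ?thesis
  proof (elim disjE conjE exE)
    assume "z < a" "a < j" "j < p"
    then show ?thesis using a tripL_YX_left[OF a(2)] trip_bounds(1)[OF a(2)]
      unfolding trip_def trip_via_def rot_def QY_iff by auto
  next
    assume "p < a" "a < j" "j < e"
    then show ?thesis using a tripL_YX_right[OF a(2)] trip_bounds(1)[OF a(2)] zp
      unfolding trip_def trip_via_def rot_def QY_iff by auto
  next
    fix i assume i: "i \<le> m" "a = u i" "j = c i"
    have *: "tripL QY QX (u (Suc i)) j k" using tripL_from_c a i by simp
    have "u (Suc i) < j" "z < u (Suc i)" "z < j" using u_le_p[of "Suc i"] z_less_u[of "Suc i"] c_bounds[of i] zp i by auto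
    then have "k \<noteq> z" using trip_bounds(1)[OF *] by auto
    then show ?thesis using * QY_uc[of i] i \<open>z < j\<close> unfolding trip_def trip_via_def rot_def by auto
  qed
next
  fix b d assume a: "PY j b" "PX j d" "b < d" "tripR PY PX j d k"
  \<comment> \<open>No \<open>u k\<close> occurs as \<open>j\<close>: its Y-arc ends beyond
    \<open>p\<close>, its X-arc at or before \<open>p\<close>, but here the Y-arc is the shorter
    one.\<close>
  consider (l) "z < j" "j < d" "d < p" "b < p" | (r) "p < j" "j < d" "d < e"
    using PX_cases[OF a(2)] PY_cases[OF a(1)] zp c_bounds a(3) by fastforce
  then show ?thesis
  proof cases
    case l
    then show ?thesis using a tripR_YX_left[OF a(4)] trip_bounds(2)[OF a(4)]
      unfolding trip_def trip_via_def rot_def QX_iff QY_iff by auto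
  next
    case r
    then show ?thesis using a tripR_YX_right[OF a(4)] trip_bounds(2)[OF a(4)] zp
      unfolding trip_def trip_via_def rot_def QX_iff QY_iff by auto
  qed
qed

lemma trip_rot: "trip PX PY j k \<Longrightarrow> trip QX QY (rot j) (rot k)"
  using trip_via_XY_rot trip_via_YX_rot by (auto simp: trip_def)

section \<open>The colour of the shorter arc\<close>

text \<open>Only starts \<open>u k\<close> with \<open>0 < k\<close> need care: their Y-arc still
  ends beyond \<open>p\<close>, and their X-arc ends before \<open>p\<close>.\<close>

lemma shorter_arc_XY: assumes "PX i b" "PY i d" "b < d" "i \<noteq> z"
  shows "\<exists>b d. QX i b \<and> QY i d \<and> b < d"
  using PY_cases[OF assms(2)]
proof (elim disjE conjE exE)
  fix k assume k: "k \<le> m" "i = u k" "d = c k"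
  have "k \<noteq> 0" using k assms u_0 by metis
  then obtain k' where k': "k = Suc k'" by (cases k) auto
  have "b < p" using PX_cases[OF assms(1)] assms(4) u_less_p k by fastforce
  then have "QX i b" "QY i (c k')" "b < c k'" using assms k k' QX_iff QY_uc[of k'] c_bounds[of k'] by auto
  then show ?thesis by blast
qed (use assms QX_iff QY_iff in blast)+

lemma shorter_arc_YX: assumes "PY i b" "PX i d" "b < d"
  shows "\<exists>b d. QY i b \<and> QX i d \<and> b < d"
  using PX_cases[OF assms(2)] PY_cases[OF assms(1)] assms zp pe c_bounds u_less_p unfolding QX_iff QY_iff
  by fastforce

lemma shorter_arc_p: "\<exists>b d. QY p b \<and> QX p d \<and> b < d"
  using QY_uc[of m] u_top c_bounds[of m] QX_pe by auto

end

subsection \<open>Arcs of a Kreweras word and their change under promotion\<close>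

definition weight :: "letter \<Rightarrow> letter \<Rightarrow> int" where
  "weight X l = (if l = A then 1 else if l = X then -1 else 0)"

definition height :: "(nat \<Rightarrow> letter) \<Rightarrow> nat \<Rightarrow> letter \<Rightarrow> nat \<Rightarrow> int" where
  "height g t X i = (\<Sum>j = t..<i. weight X (g j))"

text \<open>\<open>height g t X i\<close> counts letters before \<open>i\<close>. So the
  \<open>A\<close> at \<open>a\<close> steps up from some level and, for
  \<open>X \<noteq> A\<close>, the \<open>X\<close> at \<open>b\<close> is the first to step back to
  it: this is parenthesis matching.\<close>

definition arc :: "(nat \<Rightarrow> letter) \<Rightarrow> nat \<Rightarrow> nat \<Rightarrow> letter \<Rightarrow> nat \<Rightarrow> nat \<Rightarrow> bool" where
  "arc g t e X a b \<longleftrightarrow> t \<le> a \<and> a < b \<and> b < e \<and> height g t X (Suc b) = height g t X a \<and>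
     (\<forall>i. a < i \<and> i \<le> b \<longrightarrow> height g t X a < height g t X i)"

text \<open>A nonempty Kreweras word at the positions \<open>t, ..., e - 1\<close>; equal letter
  counts become height 0 at \<open>e\<close>, the prefix conditions become nonnegative
  heights.\<close>

definition window :: "(nat \<Rightarrow> letter) \<Rightarrow> nat \<Rightarrow> nat \<Rightarrow> bool" where
  "window g t e \<longleftrightarrow> t < e \<and> (\<forall>X\<in>{B, C}. height g t X e = 0 \<and> (\<forall>i. t \<le> i \<and> i \<le> e \<longrightarrow> 0 \<le> height g t X i))"

text \<open>The absolute position of the returning letter. The height after reading it is taken at
  \<open>Suc p\<close>, so in a window \<open>p - t\<close> is one less than
  \<open>iota\<close>.\<close>

definition first_return :: "(nat \<Rightarrow> letter) \<Rightarrow> nat \<Rightarrow> nat" where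
  "first_return g t = (LEAST p. t \<le> p \<and> (height g t B (Suc p) = 0 \<or> height g t C (Suc p) = 0))"

lemma height_start [simp]: "height g t X t = 0" by (simp add: height_def)

lemma height_Suc: "t \<le> i \<Longrightarrow> height g t X (Suc i) = height g t X i + weight X (g i)"
  by (simp add: height_def)

lemma weight_bounds: "-1 \<le> weight X l" "weight X l \<le> 1" by (auto simp: weight_def)

text \<open>Heights change by at most 1 per step, so no level is skipped. This provides the
  \<open>u n\<close>; \<open>first_passage\<close> provides the \<open>c n\<close>.\<close>

lemma last_passage:
  assumes "t \<le> p" "0 \<le> k" "k \<le> height g t X p"
  shows "\<exists>i. t \<le> i \<and> i \<le> p \<and> height g t X i = k \<and> (\<forall>j. i < j \<and> j \<le> p \<longrightarrow> k < height g t X j)"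
  using assms
proof (induction p rule: dec_induct)
  case base then show ?case by auto
next
  case (step p)
  show ?case
  proof (cases "k = height g t X (Suc p)")
    case True then show ?thesis using step by (intro exI[of _ "Suc p"]) auto
  next
    case False
    then have "k < height g t X (Suc p)" "k \<le> height g t X p"
      using step weight_bounds[of X "g p"] by (auto simp: height_Suc)
    with step obtain i where "t \<le> i \<and> i \<le> p \<and> height g t X i = k \<and> (\<forall>j. i < j \<and> j \<le> p \<longrightarrow> k < height g t X j)" by auto
    then show ?thesis using \<open>k < height g t X (Suc p)\<close> by (intro exI[of _ i]) (auto simp: le_Suc_eq)
  qed
qed

lemma first_passage:
  assumes "p \<le> e" "t \<le> p" "k < height g t X p" "height g t X e \<le> k"
  shows "\<exists>i. p \<le> i \<and> i < e \<and> height g t X (Suc i) = k \<and> (\<forall>j. p \<le> j \<and> j \<le> i \<longrightarrow> k < height g t X j)"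
  using assms
proof (induction e rule: dec_induct)
  case base then show ?case by auto
next
  case (step e)
  show ?case
  proof (cases "\<exists>j. p \<le> j \<and> j \<le> e \<and> height g t X j \<le> k")
    case True
    then obtain j where j: "p \<le> j" "j \<le> e" "height g t X j \<le> k" by auto
    define j0 where "j0 = (LEAST j. p \<le> j \<and> height g t X j \<le> k)"
    have j0: "p \<le> j0" "height g t X j0 \<le> k" using LeastI[of "\<lambda>j. p \<le> j \<and> height g t X j \<le> k" j] j by (auto simp: j0_def)
    have min: "k < height g t X i" if "p \<le> i" "i < j0" for i
      using not_less_Least[of i "\<lambda>j. p \<le> j \<and> height g t X j \<le> k"] that by (auto simp: j0_def)
    have "j0 \<noteq> p" using j0 step by auto
    then obtain i where i: "j0 = Suc i" "p \<le> i" using j0 by (cases j0) auto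
    have "j0 \<le> j" unfolding j0_def by (rule Least_le) (use j in auto)
    have "height g t X (Suc i) = k" using min[of i] j0 i weight_bounds[of X "g i"] step by (auto simp: height_Suc)
    then show ?thesis using i min j \<open>j0 \<le> j\<close> by (intro exI[of _ i]) auto
  next
    case False
    then have "\<forall>j. p \<le> j \<and> j \<le> e \<longrightarrow> k < height g t X j" by auto
    moreover from this have "height g t X (Suc e) = k" using step weight_bounds[of X "g e"]
      by (smt (verit, best) height_Suc order_trans order_refl)
    ultimately show ?thesis using step by (intro exI[of _ e]) auto
  qed
qed

lemma first_return_props:
  assumes "window g t e" and p: "p = first_return g t"
  shows "t < p" "p < e" "g p \<in> {B, C}" "height g t (g p) (Suc p) = 0" "g t = A"
    "\<And>X i. X \<in> {B, C} \<Longrightarrow> t < i \<Longrightarrow> i \<le> p \<Longrightarrow> 0 < height g t X i"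
proof -
  let ?P = "\<lambda>p. t \<le> p \<and> (height g t B (Suc p) = 0 \<or> height g t C (Suc p) = 0)"
  have te: "t < e" and h: "\<And>X. X \<in> {B, C} \<Longrightarrow> height g t X e = 0"
    and pos: "\<And>X i. X \<in> {B, C} \<Longrightarrow> t \<le> i \<Longrightarrow> i \<le> e \<Longrightarrow> 0 \<le> height g t X i"
    using assms(1) by (auto simp: window_def)
  have e: "?P (e - 1)" using te h by auto
  have Pp: "?P p" using LeastI[of ?P, OF e] by (simp add: p first_return_def)
  have "p \<le> e - 1" using Least_le[of ?P, OF e] by (simp add: p first_return_def)
  then show pe: "p < e" using te by simp
  have least: "\<not> ?P i" if "i < p" for i using not_less_Least[of i ?P] that by (simp add: p first_return_def)
  show gt: "0 < height g t X i" if "X \<in> {B, C}" "t < i" "i \<le> p" for X i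
  proof -
    have "\<not> ?P (i - 1)" using that by (intro least) auto
    then have "height g t X i \<noteq> 0" using that by auto
    then show ?thesis using pos[of X i] that pe by auto
  qed
  show "g t = A"
    using pos[of B "Suc t"] pos[of C "Suc t"] te by (cases "g t") (auto simp: height_Suc weight_def)
  then have "p \<noteq> t" using Pp by (auto simp: height_Suc weight_def)
  then show tp: "t < p" using Pp by auto
  \<comment> \<open>Both heights are positive at \<open>p\<close>, so the letter at \<open>p\<close>
    must be the one whose height drops to 0.\<close>
  show "g p \<in> {B, C}" "height g t (g p) (Suc p) = 0"
    using gt[of B p] gt[of C p] Pp tp by (cases "g p"; auto simp: height_Suc weight_def)+
qed

lemma swap_BC_swap_BC [simp]: "swap_BC (swap_BC X) = X" by (cases X) auto

text \<open>Everything follows from comparing heights. Up to \<open>p\<close> both drop by 1,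
  because the \<open>A\<close> at \<open>t\<close> is gone. Replacing \<open>X\<close> by
  \<open>A\<close> at \<open>p\<close> then adds 2 for \<open>X\<close> and 1 for \<open>Y\<close>,
  so beyond \<open>p\<close> the heights are \<open>h + 1\<close> and \<open>k\<close>.\<close>

lemma promotion_step_rotation:
  assumes w: "window g t e" and p: "p = first_return g t" and X: "X = g p" and Y: "Y = swap_BC X"
    and g': "g' = g(p := A, e := X)"
  shows "\<exists>m u c. rotation t e p m u c (arc g t e X) (arc g t e Y) (arc g' (Suc t) (Suc e) X) (arc g' (Suc t) (Suc e) Y)"
    and "window g' (Suc t) (Suc e)"
proof -
  note fr = first_return_props[OF w p]
  have tp: "t < p" and pe: "p < e" using fr by auto
  have XY: "X \<in> {B, C}" "Y \<in> {B, C}" "X \<noteq> Y" using fr X Y by auto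
  then have BC: "{B, C} = {X, Y}" by auto
  have pos: "\<And>Z i. Z \<in> {B, C} \<Longrightarrow> t \<le> i \<Longrightarrow> i \<le> e \<Longrightarrow> 0 \<le> height g t Z i"
    and he: "\<And>Z. Z \<in> {B, C} \<Longrightarrow> height g t Z e = 0"
    using w by (auto simp: window_def)
  define h where "h = height g t X"
  define k where "k = height g t Y"
  define h' where "h' = height g' (Suc t) X"
  define k' where "k' = height g' (Suc t) Y"
  have k0: "k t = 0" "h t = 0" "k e = 0" "h e = 0" using he XY by (auto simp: h_def k_def)
  have hk_pos: "\<And>i. t \<le> i \<Longrightarrow> i \<le> e \<Longrightarrow> 0 \<le> h i" "\<And>i. t \<le> i \<Longrightarrow> i \<le> e \<Longrightarrow> 0 \<le> k i"
    "\<And>i. t < i \<Longrightarrow> i \<le> p \<Longrightarrow> 0 < h i" "\<And>i. t < i \<Longrightarrow> i \<le> p \<Longrightarrow> 0 < k i"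
    using pos fr(6) XY by (auto simp: h_def k_def)
  have hp: "h (Suc p) = 0" "h p = 1" "k (Suc p) = k p"
    using fr X XY tp by (auto simp: h_def k_def height_Suc weight_def)
  have low: "h' i = h i - 1 \<and> k' i = k i - 1" if "Suc t \<le> i" "i \<le> p" for i
    using that
  proof (induction i rule: dec_induct)
    case base
    then show ?case using fr(5) by (auto simp: h_def k_def h'_def k'_def height_Suc weight_def)
  next
    case (step i)
    then have "g' i = g i" using g' pe by auto
    with step show ?case by (auto simp: h_def k_def h'_def k'_def height_Suc)
  qed
  have high: "h' i = h i + 1 \<and> k' i = k i" if "Suc p \<le> i" "i \<le> e" for i
    using that
  proof (induction i rule: dec_induct)
    case base
    have "g' p = A" using g' pe by auto
    then show ?case using low[of p] tp hp by (auto simp: h_def k_def h'_def k'_def height_Suc weight_def)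
  next
    case (step i)
    then have "g' i = g i" using g' pe by auto
    with step tp show ?case by (auto simp: h_def k_def h'_def k'_def height_Suc)
  qed
  have "g' e = X" using g' by simp
  then have top: "h' (Suc e) = 0" "k' (Suc e) = 0"
    using high[of e] pe tp k0 XY by (auto simp: h'_def k'_def height_Suc weight_def)
  have "0 \<le> h' i \<and> 0 \<le> k' i" if i: "Suc t \<le> i" "i \<le> Suc e" for i
  proof -
    consider "i \<le> p" | "Suc p \<le> i" "i \<le> e" | "i = Suc e" using i by linarith
    then show ?thesis
    proof cases
      case 1 then show ?thesis using low[of i] hk_pos(3,4)[of i] i by auto
    next
      case 2 then show ?thesis using high[of i] hk_pos(1,2)[of i] tp by auto
    next
      case 3 then show ?thesis using top by simp
    qed
  qed
  then show "window g' (Suc t) (Suc e)"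
    unfolding window_def BC using top tp pe by (auto simp: h'_def k'_def)

  \<comment> \<open>The arcs over \<open>p\<close> are indexed by the levels
    \<open>0, ..., m\<close> of \<open>k\<close> below \<open>k p\<close>: \<open>u n\<close> is the
    last position up to \<open>p\<close> at level \<open>n\<close>, and the letter at
    \<open>c n\<close> is the first after \<open>p\<close> to bring \<open>k\<close> down to
    \<open>n\<close>.\<close>
  have "0 < k p" using hk_pos tp by auto
  then obtain m where m: "k p = int (Suc m)" by (metis gr0_implies_Suc zero_less_imp_eq_int)
  have "\<forall>n. \<exists>i. n \<le> Suc m \<longrightarrow> t \<le> i \<and> i \<le> p \<and> k i = int n \<and> (\<forall>j. i < j \<and> j \<le> p \<longrightarrow> int n < k j)"
    using last_passage[of t p _ g Y] tp m by (auto simp: k_def)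
  then obtain u where u: "\<And>n. n \<le> Suc m \<Longrightarrow> t \<le> u n \<and> u n \<le> p \<and> k (u n) = int n \<and> (\<forall>j. u n < j \<and> j \<le> p \<longrightarrow> int n < k j)"
    by metis
  have "\<forall>n. \<exists>i. n \<le> m \<longrightarrow> Suc p \<le> i \<and> i < e \<and> k (Suc i) = int n \<and> (\<forall>j. Suc p \<le> j \<and> j \<le> i \<longrightarrow> int n < k j)"
    using first_passage[of "Suc p" e t _ g Y] tp pe m k0 hp by (auto simp: k_def)
  then obtain c where c: "\<And>n. n \<le> m \<Longrightarrow> Suc p \<le> c n \<and> c n < e \<and> k (Suc (c n)) = int n \<and> (\<forall>j. Suc p \<le> j \<and> j \<le> c n \<longrightarrow> int n < k j)"
    by metis
  have u_uniq: "a = u n" if "n \<le> Suc m" "t \<le> a" "a \<le> p" "k a = int n" "\<forall>j. a < j \<and> j \<le> p \<longrightarrow> int n < k j" for a n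
    using u[OF that(1)] that by (metis less_irrefl linorder_neqE_nat)
  have c_uniq: "b = c n" if "n \<le> m" "p < b" "k (Suc b) = int n" "\<forall>j. p < j \<and> j \<le> b \<longrightarrow> int n < k j" for b n
  proof (rule linorder_cases[of b "c n"])
    assume "b < c n"
    then have "int n < k (Suc b)" using c[OF that(1)] that(2) by auto
    then show ?thesis using that(3) by simp
  next
    assume "c n < b"
    then have "p < Suc (c n)" "Suc (c n) \<le> b" using c[OF that(1)] by auto
    then have "int n < k (Suc (c n))" using that(4) by blast
    then show ?thesis using c[OF that(1)] by simp
  qed

  have X_arc: "arc g t e X a b \<longleftrightarrow> t \<le> a \<and> a < b \<and> b < e \<and> h (Suc b) = h a \<and> (\<forall>i. a < i \<and> i \<le> b \<longrightarrow> h a < h i)" for a b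
    by (simp add: arc_def h_def)
  have Y_arc: "arc g t e Y a b \<longleftrightarrow> t \<le> a \<and> a < b \<and> b < e \<and> k (Suc b) = k a \<and> (\<forall>i. a < i \<and> i \<le> b \<longrightarrow> k a < k i)" for a b
    by (simp add: arc_def k_def)
  have X_arc': "arc g' (Suc t) (Suc e) X a b \<longleftrightarrow> t < a \<and> a < b \<and> b \<le> e \<and> h' (Suc b) = h' a \<and> (\<forall>i. a < i \<and> i \<le> b \<longrightarrow> h' a < h' i)" for a b
    by (auto simp add: arc_def h'_def)
  have Y_arc': "arc g' (Suc t) (Suc e) Y a b \<longleftrightarrow> t < a \<and> a < b \<and> b \<le> e \<and> k' (Suc b) = k' a \<and> (\<forall>i. a < i \<and> i \<le> b \<longrightarrow> k' a < k' i)" for a b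
    by (auto simp add: arc_def k'_def)

  \<comment> \<open>No X-arc starts at \<open>p\<close> or passes over it, since
    \<open>h (Suc p) = 0\<close> is the lowest level.\<close>
  have X_cases: "(a = t \<and> b = p) \<or> (t < a \<and> a < b \<and> b < p) \<or> (p < a \<and> a < b \<and> b < e)" if "arc g t e X a b" for a b
  proof -
    have ab: "t \<le> a" "a < b" "b < e" "h (Suc b) = h a" "\<And>i. a < i \<Longrightarrow> i \<le> b \<Longrightarrow> h a < h i" using that X_arc by auto
    consider "p < a" | "a = p" | "a < p" "p < b" | "a < p" "b = p" | "a < p" "b < p" using ab by linarith
    then show ?thesis
    proof cases
      case 2 then show ?thesis using ab(5)[of "Suc p"] hp ab by auto
    next
      case 3 then show ?thesis using ab(5)[of "Suc p"] hp hk_pos(1)[of a] ab by auto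
    next
      case 4 then show ?thesis using hp hk_pos(3)[of a] ab by (cases "a = t") auto
    next
      case 5 then show ?thesis using hk_pos(3)[of "Suc b"] k0 ab by (cases "a = t") auto
    qed (use ab in auto)
  qed
  have X_tp: "arc g t e X t p" unfolding X_arc using tp pe hp k0 hk_pos(3) by auto
  \<comment> \<open>The new \<open>A\<close> at \<open>p\<close> lifts \<open>h'\<close> from 0, and
    \<open>h' = h + 1\<close> stays positive until the \<open>X\<close> at \<open>e\<close>: this is
    the arc \<open>(p, e)\<close>. The other arcs lie on one side of \<open>p\<close>, where
    \<open>h' - h\<close> is constant.\<close>
  have X_iff: "arc g' (Suc t) (Suc e) X a b \<longleftrightarrow> (a = p \<and> b = e) \<or> (arc g t e X a b \<and> a \<noteq> t)" for a b
  proof -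
    have pe': "arc g' (Suc t) (Suc e) X p e"
      unfolding X_arc' using tp pe top low[of p] hp high hk_pos(1) by (auto simp: Suc_le_eq)
    have l: "arc g' (Suc t) (Suc e) X a b = arc g t e X a b" if "t < a" "b < p" for a b
      unfolding X_arc X_arc' using that low pe by (auto simp: Suc_le_eq)
    have r: "arc g' (Suc t) (Suc e) X a b = arc g t e X a b" if "p < a" "b < e" for a b
      unfolding X_arc X_arc' using that high tp by (auto simp: Suc_le_eq)
    have cs: "(a = p \<and> b = e) \<or> (t < a \<and> b < p) \<or> (p < a \<and> b < e)" if "arc g' (Suc t) (Suc e) X a b"
    proof -
      have ab: "t < a" "a < b" "b \<le> e" "h' (Suc b) = h' a" "\<And>i. a < i \<Longrightarrow> i \<le> b \<Longrightarrow> h' a < h' i" using that X_arc' by auto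
      consider "p < a" "b < e" | "p < a" "b = e" | "a \<le> p" "p < b" "b < e" | "a < p" "b = e" | "a = p" "b = e"
        | "a < p" "b = p" | "a < p" "b < p" using ab by linarith
      then show ?thesis
      proof cases
        case 2 then show ?thesis using high[of a] hk_pos(1)[of a] ab top tp by auto
      next
        case 3 then show ?thesis using high[of "Suc b"] hk_pos(1)[of "Suc b"] low[of a] low[of p] ab(5)[of p] hp tp ab by (cases "a = p") auto
      next
        case 4 then show ?thesis using ab(5)[of p] low[of p] low[of a] hp tp pe hk_pos(3)[of a] ab by auto
      next
        case 6 then show ?thesis using ab(5)[of p] ab(4) low[of p] low[of a] hp high[of "Suc p"] tp hk_pos(3)[of a] ab pe by auto
      qed (use ab in auto)
    qed
    show ?thesis using cs pe' l r X_cases[of a b] tp pe by (metis less_irrefl less_trans)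
  qed

  have Y_cases: "(t < a \<and> a < b \<and> b < p) \<or> (p < a \<and> a < b \<and> b < e) \<or> (\<exists>n\<le>m. a = u n \<and> b = c n)" if "arc g t e Y a b" for a b
  proof -
    have ab: "t \<le> a" "a < b" "b < e" "k (Suc b) = k a" "\<And>i. a < i \<Longrightarrow> i \<le> b \<Longrightarrow> k a < k i" using that Y_arc by auto
    consider "p < a" | "a = p" | "a < p" "p < b" | "a < p" "b = p" | "a < p" "b < p" using ab by linarith
    then show ?thesis
    proof cases
      case 2 then show ?thesis using ab(5)[of "Suc p"] hp ab by auto
    next
      case 3
      obtain n where n: "k a = int n" using hk_pos(2)[of a] ab by (metis nonneg_int_cases less_imp_le less_trans)
      have "n \<le> m" using ab(5)[of p] 3 n m by auto
      moreover have "a = u n" using u_uniq[of n a] \<open>n \<le> m\<close> ab n 3 by auto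
      moreover have "b = c n" using c_uniq[of n b] \<open>n \<le> m\<close> ab n 3 by auto
      ultimately show ?thesis by auto
    next
      case 4
      then have "k a < k p" by (intro ab(5)) auto
      moreover have "k p = k a" using 4 hp ab by auto
      ultimately show ?thesis by simp
    next
      case 5 then show ?thesis using hk_pos(4)[of "Suc b"] k0 ab by (cases "a = t") auto
    qed (use ab in auto)
  qed
  have u_props: "u 0 = t" "u (Suc m) = p" "\<And>i j. i < j \<Longrightarrow> j \<le> Suc m \<Longrightarrow> u i < u j"
  proof -
    show "u 0 = t" using u_uniq[of 0 t] tp k0 hk_pos(4) by auto
    show "u (Suc m) = p" using u_uniq[of "Suc m" p] tp m by auto
    fix i j assume ij: "i < j" "j \<le> Suc m"
    show "u i < u j"
    proof (rule ccontr)
      assume "\<not> u i < u j"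
      then have "u i = u j \<or> u j < u i" by auto
      then show False using u[of i] u[of j] ij by auto
    qed
  qed
  have c_anti: "c j < c i" if "i < j" "j \<le> m" for i j
  proof (rule ccontr)
    assume "\<not> c j < c i"
    then have "c i = c j \<or> Suc (c i) \<le> c j" by auto
    then show False
    proof
      assume "Suc (c i) \<le> c j"
      moreover have "Suc p \<le> Suc (c i)" using c[of i] that by auto
      ultimately have "int j < k (Suc (c i))" using c[of j] that by blast
      then show False using c[of i] that by auto
    qed (use c[of i] c[of j] that in auto)
  qed
  have Y_uc: "arc g t e Y (u n) (c n)" if "n \<le> m" for n
    unfolding Y_arc using u[of n] c[of n] that u_props(2) u_props(3)[of n "Suc m"]
    by (auto simp: Suc_le_eq) (metis not_le)
  \<comment> \<open>Since \<open>k' = k - 1\<close> up to \<open>p\<close> and \<open>k' = k\<close>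
    beyond, old level \<open>n + 1\<close> on the left now matches level \<open>n\<close> on the
    right.\<close>
  have Y_uc': "arc g' (Suc t) (Suc e) Y (u (Suc n)) (c n)" if "n \<le> m" for n
  proof -
    have un: "t < u (Suc n)" "u (Suc n) \<le> p" using u_props(1) u_props(3)[of 0 "Suc n"] u[of "Suc n"] that by auto
    have cn: "p < c n" "c n < e" using c[of n] that by auto
    have a: "k' (u (Suc n)) = int n" using low[of "u (Suc n)"] u[of "Suc n"] un that by auto
    have "int n < k' i" if i: "u (Suc n) < i" "i \<le> c n" for i
    proof (cases "i \<le> p")
      case True then show ?thesis using low[of i] u[of "Suc n"] un i \<open>n \<le> m\<close> by auto
    next
      case False then show ?thesis using high[of i] c[of n] cn i \<open>n \<le> m\<close> by auto
    qed
    moreover have "k' (Suc (c n)) = int n" using high[of "Suc (c n)"] cn c[of n] that by auto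
    ultimately show ?thesis unfolding Y_arc' using a un cn by auto
  qed
  have Y_iff: "arc g' (Suc t) (Suc e) Y a b \<longleftrightarrow> (arc g t e Y a b \<and> (b < p \<or> p < a)) \<or> (\<exists>n\<le>m. a = u (Suc n) \<and> b = c n)" for a b
  proof -
    have l: "arc g' (Suc t) (Suc e) Y a b = arc g t e Y a b" if "t < a" "b < p" for a b
      unfolding Y_arc Y_arc' using that low pe by (auto simp: Suc_le_eq)
    have r: "arc g' (Suc t) (Suc e) Y a b = arc g t e Y a b" if "p < a" "b < e" for a b
      unfolding Y_arc Y_arc' using that high tp by (auto simp: Suc_le_eq)
    have cs: "(t < a \<and> b < p) \<or> (p < a \<and> b < e) \<or> (\<exists>n\<le>m. a = u (Suc n) \<and> b = c n)" if "arc g' (Suc t) (Suc e) Y a b"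
    proof -
      have ab: "t < a" "a < b" "b \<le> e" "k' (Suc b) = k' a" "\<And>i. a < i \<Longrightarrow> i \<le> b \<Longrightarrow> k' a < k' i" using that Y_arc' by auto
      consider "p < a" "b < e" | "b = e" | "a \<le> p" "p < b" "b < e" | "a < p" "b = p" | "a < p" "b < p" using ab by linarith
      then show ?thesis
      proof cases
        case 2 then show ?thesis using high[of e] ab(5)[of e] ab(4) k0 top pe ab by auto
      next
        case 3
        obtain n where n: "k (Suc b) = int n" using hk_pos(2)[of "Suc b"] 3 tp by (auto elim: nonneg_int_cases)
        have ka: "k a = int (Suc n)" using n low[of a] high[of "Suc b"] ab 3 by auto
        have gt: "int (Suc n) < k j" if "a < j" "j \<le> p" for j
          using that ab(5)[of j] low[of j] low[of a] ka ab 3 by auto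
        have "n \<le> m" using gt[of p] ka m 3 by (cases "a = p") auto
        moreover have "a = u (Suc n)" using u_uniq[of "Suc n" a] \<open>n \<le> m\<close> ab ka gt 3 by auto
        moreover have "int n < k j" if "p < j" "j \<le> b" for j
          using that ab(5)[of j] high[of j] low[of a] ka ab 3 by auto
        then have "b = c n" using c_uniq[of n b] \<open>n \<le> m\<close> n 3 by auto
        ultimately show ?thesis by auto
      next
        case 4 then show ?thesis using ab(5)[of p] ab(4) low[of p] hp high[of "Suc p"] tp ab pe by auto
      qed (use ab in auto)
    qed
    show ?thesis
    proof
      assume "arc g' (Suc t) (Suc e) Y a b"
      then show "(arc g t e Y a b \<and> (b < p \<or> p < a)) \<or> (\<exists>n\<le>m. a = u (Suc n) \<and> b = c n)"
        using cs l r by blast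
    next
      assume R: "(arc g t e Y a b \<and> (b < p \<or> p < a)) \<or> (\<exists>n\<le>m. a = u (Suc n) \<and> b = c n)"
      show "arc g' (Suc t) (Suc e) Y a b"
      proof (cases "\<exists>n\<le>m. a = u (Suc n) \<and> b = c n")
        case True then show ?thesis using Y_uc' by auto
      next
        case False
        then have Y: "arc g t e Y a b" "b < p \<or> p < a" using R by auto
        then have "(t < a \<and> b < p) \<or> (p < a \<and> b < e)" using Y_cases[OF Y(1)] c u by fastforce
        then show ?thesis using l r Y by auto
      qed
    qed
  qed
  have "rotation t e p m u c (arc g t e X) (arc g t e Y) (arc g' (Suc t) (Suc e) X) (arc g' (Suc t) (Suc e) Y)"
    by unfold_locales (use tp pe X_tp X_cases X_iff u_props c_anti c Y_uc Y_cases Y_iff in \<open>(simp add: Suc_le_eq | blast)+\<close>)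
  then show "\<exists>m u c. rotation t e p m u c (arc g t e X) (arc g t e Y) (arc g' (Suc t) (Suc e) X) (arc g' (Suc t) (Suc e) Y)"
    by blast
qed

subsection \<open>Iterated promotion\<close>

lemma trip_sym: "trip P Q j k \<longleftrightarrow> trip Q P j k"
  by (auto simp: trip_def)

text \<open>Positions are never shifted; at time \<open>t\<close> only the values at
  \<open>t, ..., t + N - 1\<close> belong to the word, those below \<open>t\<close> are
  leftovers.\<close>

primrec evolve :: "nat \<Rightarrow> (nat \<Rightarrow> letter) \<Rightarrow> nat \<Rightarrow> nat \<Rightarrow> letter" where
  "evolve N g 0 = g"
| "evolve N g (Suc t) = (let h = evolve N g t; p = first_return h t in h(p := A, t + N := h p))"

locale kreweras_evolution =
  fixes N :: nat and g :: "nat \<Rightarrow> letter"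
  assumes window_0: "window g 0 N"
begin

abbreviation G where "G t \<equiv> evolve N g t"
definition ret where "ret t = first_return (G t) t"
definition lett where "lett t = G t (ret t)"
abbreviation arcs where "arcs t X \<equiv> arc (G t) t (t + N) X"

lemma G_Suc: "G (Suc t) = (G t)(ret t := A, t + N := lett t)"
  by (simp add: ret_def lett_def Let_def)

lemma window_G: "window (G t) t (t + N)"
proof (induction t)
  case 0 then show ?case using window_0 by simp
next
  case (Suc t)
  show ?case using promotion_step_rotation(2)[OF Suc ret_def lett_def refl G_Suc] by simp
qed

lemma rotation_G:
  "\<exists>m u c. rotation t (t + N) (ret t) m u c (arcs t (lett t)) (arcs t (swap_BC (lett t)))
     (arcs (Suc t) (lett t)) (arcs (Suc t) (swap_BC (lett t)))"
  using promotion_step_rotation(1)[OF window_G ret_def lett_def refl G_Suc] by simp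

lemmas ret_props = first_return_props[OF window_G ret_def, folded lett_def]

text \<open>Trips are symmetric in the two families of arcs, so it does not matter which letter
  returns first.\<close>

lemma trip_BC: "trip (arcs s (lett t)) (arcs s (swap_BC (lett t))) = trip (arcs s B) (arcs s C)"
  using ret_props(3)[of t] trip_sym by fastforce

lemma trip_ret: "trip (arcs t B) (arcs t C) (ret t) t"
  using rotation_G[of t] rotation.trip_p_z trip_BC by metis

lemma trip_ret_unique: "trip (arcs t B) (arcs t C) j t \<Longrightarrow> j = ret t"
  using rotation_G[of t] rotation.trip_z_unique trip_BC by metis

lemma trip_Suc:
  assumes "trip (arcs t B) (arcs t C) j k"
  shows "trip (arcs (Suc t) B) (arcs (Suc t) C) (if j = t then t + N else j) (if k = t then t + N else k)"
proof -
  obtain m u c where "rotation t (t + N) (ret t) m u c (arcs t (lett t)) (arcs t (swap_BC (lett t)))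
     (arcs (Suc t) (lett t)) (arcs (Suc t) (swap_BC (lett t)))"
    using rotation_G by blast
  then interpret rotation t "t + N" "ret t" m u c "arcs t (lett t)" "arcs t (swap_BC (lett t))"
     "arcs (Suc t) (lett t)" "arcs (Suc t) (swap_BC (lett t))" .
  show ?thesis using trip_rot assms unfolding trip_BC rot_def by blast
qed

text \<open>The step from time \<open>i\<close> renames \<open>i\<close> to \<open>i + N\<close>; by
  \<open>s \<le> N\<close> the new name is not reached again.\<close>

lemma trip_add:
  assumes "trip (arcs t B) (arcs t C) j k" "t \<le> j" "t \<le> k" "s \<le> N"
  shows "trip (arcs (t + s) B) (arcs (t + s) C) (if j < t + s then j + N else j) (if k < t + s then k + N else k)"
  using assms(4)
proof (induction s)
  case 0 then show ?case using assms by simp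
next
  case (Suc s)
  then have "trip (arcs (t + s) B) (arcs (t + s) C) (if j < t + s then j + N else j) (if k < t + s then k + N else k)"
    by simp
  moreover have "(if (if i < t + s then i + N else i) = t + s then t + s + N else (if i < t + s then i + N else i))
    = (if i < t + Suc s then i + N else i)" if "t \<le> i" for i
    using that Suc.prems by auto
  ultimately show ?case using trip_Suc[of "t + s"] assms(2,3) by fastforce
qed

text \<open>\<open>N\<close> steps carry the trip from \<open>ret t\<close> to \<open>t\<close> into
  one from \<open>ret t + N\<close> to \<open>t + N\<close>, and only \<open>ret (t + N)\<close> has
  a trip ending there.\<close>

lemma ret_add_N: "ret (t + N) = ret t + N"
proof -
  have r: "t < ret t" "ret t < t + N" using ret_props(1,2)[of t] by auto
  have "trip (arcs (t + N) B) (arcs (t + N) C) (ret t + N) (t + N)"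
    using trip_add[OF trip_ret[of t], where s = N] r by auto
  then show ?thesis using trip_ret_unique by force
qed

text \<open>The colour of an \<open>A\<close> at \<open>i\<close>: the letter \<open>X\<close>
  closing the shorter of its two arcs.\<close>

definition shorter_arc where
  "shorter_arc t X i \<longleftrightarrow> (\<exists>b d. arcs t X i b \<and> arcs t (swap_BC X) i d \<and> b < d)"

lemma shorter_arc_Suc:
  assumes "shorter_arc t X i" "i \<noteq> t" "X \<in> {B, C}"
  shows "shorter_arc (Suc t) X i"
proof -
  have "X = lett t \<or> X = swap_BC (lett t)" using assms ret_props(3)[of t] by auto
  then show ?thesis
    using rotation_G[of t] rotation.shorter_arc_XY rotation.shorter_arc_YX assms
    unfolding shorter_arc_def by (elim disjE) (metis swap_BC_swap_BC)+
qed

lemma shorter_arc_ret: "shorter_arc (Suc t) (swap_BC (lett t)) (ret t)"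
  using rotation_G[of t] rotation.shorter_arc_p unfolding shorter_arc_def swap_BC_swap_BC by blast

lemma shorter_arc_start:
  assumes "shorter_arc t X t" "X \<in> {B, C}"
  shows "lett t = X"
proof (rule ccontr)
  assume "lett t \<noteq> X"
  then have "X = swap_BC (lett t)" using assms ret_props(3)[of t] by auto
  then obtain b d where "arcs t (swap_BC (lett t)) t b" "arcs t (lett t) t d" "b < d"
    using assms by (auto simp: shorter_arc_def)
  then show False using rotation_G[of t] rotation.arc_X_shorter_at_z by (metis less_asym)
qed

text \<open>Follows the letter written to \<open>t + N\<close> at time \<open>Suc t\<close>. A hit
  by a first return turns it into an \<open>A\<close> whose shorter arc has the swapped colour; an
  \<open>A\<close> is never hit, and its colour persists while it is not the first letter.\<close>

lemma colour_invariant: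
  assumes "s < N"
  shows "G (t + Suc s) (t + N) = lett t \<or>
    G (t + Suc s) (t + N) = A \<and> shorter_arc (t + Suc s) (swap_BC (lett t)) (t + N)"
  using assms
proof (induction s)
  case 0
  then show ?case by (simp add: G_Suc del: evolve.simps)
next
  case (Suc s)
  define v where "v = t + Suc s"
  have v: "t + Suc (Suc s) = Suc v" "t < v" "v < t + N" using Suc by (auto simp: v_def)
  have IH: "G v (t + N) = lett t \<or> G v (t + N) = A \<and> shorter_arc v (swap_BC (lett t)) (t + N)"
    using Suc by (simp add: v_def del: evolve.simps)
  have BC: "lett t \<in> {B, C}" "lett v \<in> {B, C}" using ret_props(3) by blast+
  show ?case
  proof (cases "ret v = t + N")
    case True
    then have "G v (t + N) = lett v" by (simp add: lett_def)
    then have "lett v = lett t" using IH BC by auto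
    then show ?thesis using shorter_arc_ret[of v] True v by (simp add: G_Suc del: evolve.simps)
  next
    case False
    then have "G (Suc v) (t + N) = G v (t + N)" using v by (simp add: G_Suc del: evolve.simps)
    then show ?thesis using IH shorter_arc_Suc[of v "swap_BC (lett t)" "t + N"] v BC by auto
  qed
qed

text \<open>At time \<open>t + N\<close> the position \<open>t + N\<close> comes first and holds an
  \<open>A\<close>, so the second alternative of the invariant applies; the shorter arc of the first
  \<open>A\<close> leads to the first return.\<close>

lemma lett_add_N: "lett (t + N) = swap_BC (lett t)"
proof -
  have "0 < N" using window_0 by (simp add: window_def)
  then have "G (t + N) (t + N) = lett t \<or>
    G (t + N) (t + N) = A \<and> shorter_arc (t + N) (swap_BC (lett t)) (t + N)"
    using colour_invariant[of "N - 1" t] by simp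
  moreover have "G (t + N) (t + N) = A" "lett t \<in> {B, C}" using ret_props by blast+
  ultimately show ?thesis using shorter_arc_start[of "t + N"] by auto
qed

text \<open>Time runs forward until \<open>j\<close> is hit, where \<open>ret_add_N\<close> and
  \<open>lett_add_N\<close> apply, or comes first, where both letters are \<open>A\<close>. Until
  then neither letter changes.\<close>

lemma G_add_N:
  assumes "t \<le> j" "j < t + N"
  shows "G (t + N) (j + N) = swap_BC (G t j)"
  using assms
proof (induction "j - t" arbitrary: t)
  case 0
  then have "j = t" by simp
  then show ?case using ret_props(5)[of t] ret_props(5)[of "t + N"] by simp
next
  case (Suc d)
  show ?case
  proof (cases "ret t = j")
    case True
    then show ?thesis using ret_add_N[of t] lett_add_N[of t] by (simp add: lett_def)
  next
    case False
    have "G (Suc t) j = G t j" using False Suc.prems by (simp add: G_Suc del: evolve.simps)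
    moreover have "G (Suc (t + N)) (j + N) = G (t + N) (j + N)"
      using False Suc.prems ret_add_N[of t] by (simp add: G_Suc del: evolve.simps)
    moreover have "G (Suc t + N) (j + N) = swap_BC (G (Suc t) j)"
      using Suc by (intro Suc.hyps(1)) auto
    ultimately show ?thesis by simp
  qed
qed

end

section \<open>From windows back to lists\<close>

lemma height_count:
  assumes "X \<noteq> A" "i \<le> N"
  shows "height g t X (t + i) =
    int (count_list (take i (map g [t..<t + N])) A) - int (count_list (take i (map g [t..<t + N])) X)"
  using assms(2)
proof (induction i)
  case 0 then show ?case by simp
next
  case (Suc i)
  have "take (Suc i) (map g [t..<t + N]) = take i (map g [t..<t + N]) @ [g (t + i)]"
    using Suc.prems by (subst take_Suc_conv_app_nth) auto
  then show ?case using Suc assms(1) by (auto simp: height_Suc weight_def)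
qed

lemma iota_first_return:
  assumes w: "window g t (t + N)"
  shows "iota (map g [t..<t + N]) = Suc (first_return g t - t)"
proof -
  define p where "p = first_return g t"
  note fr = first_return_props[OF w p_def]
  have h: "height g t X (t + i) = 0 \<longleftrightarrow>
      count_list (take i (map g [t..<t + N])) A = count_list (take i (map g [t..<t + N])) X"
    if "X \<noteq> A" "i \<le> N" for X i using height_count[OF that, of g t] by simp
  show ?thesis unfolding iota_def p_def[symmetric]
  proof (rule Least_equality)
    have "Suc (p - t) \<le> N" "t + Suc (p - t) = Suc p" using fr(1,2) by auto
    then show "1 \<le> Suc (p - t) \<and> (count_list (take (Suc (p - t)) (map g [t..<t + N])) A = count_list (take (Suc (p - t)) (map g [t..<t + N])) B \<or>
      count_list (take (Suc (p - t)) (map g [t..<t + N])) A = count_list (take (Suc (p - t)) (map g [t..<t + N])) C)"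
      using h[of B "Suc (p - t)"] h[of C "Suc (p - t)"] fr(3,4) by auto
  next
    fix y assume y: "1 \<le> y \<and> (count_list (take y (map g [t..<t + N])) A = count_list (take y (map g [t..<t + N])) B \<or>
      count_list (take y (map g [t..<t + N])) A = count_list (take y (map g [t..<t + N])) C)"
    show "Suc (p - t) \<le> y"
    proof (rule ccontr)
      assume "\<not> ?thesis"
      then have "t + y \<le> p" "y \<le> N" using fr(1,2) by auto
      then show False using y h[of B y] h[of C y] fr(6)[of B "t + y"] fr(6)[of C "t + y"] by auto
    qed
  qed
qed

lemma pro_window:
  assumes w: "window g t (t + N)" and p: "p = first_return g t"
  shows "pro (map g [t..<t + N]) = map (g(p := A, t + N := g p)) [Suc t..<Suc (t + N)]"
proof -
  have tp: "t < p" "p < t + N" using first_return_props[OF w p] by auto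
  \<comment> \<open>The four blocks of \<open>pro\<close>: as \<open>iota\<close> is
    \<open>Suc (p - t)\<close>, taking \<open>iota - 2\<close> letters after the first one covers
    \<open>t + 1, ..., p - 1\<close>.\<close>
  have "[Suc t..<Suc (t + N)] = [Suc t..<p] @ [p] @ [Suc p..<t + N] @ [t + N]"
    using tp upt_add_eq_append[of "Suc t" p "t + N - p"] by (simp add: upt_conv_Cons)
  moreover have "map g [t..<t + N] ! (p - t) = g p" using tp by simp
  ultimately show ?thesis
    using tp unfolding pro_def iota_first_return[OF w] p[symmetric]
    by (simp add: drop_map take_map Suc_diff_Suc)
qed

lemma (in kreweras_evolution) pro_power: "(pro ^^ t) (map g [0..<N]) = map (G t) [t..<t + N]"
proof (induction t)
  case (Suc t)
  then show ?case using pro_window[OF window_G ret_def, of t]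
    by (simp add: G_Suc lett_def[symmetric] del: evolve.simps upt_Suc)
qed simp

lemma kreweras_word_window:
  assumes "n \<ge> 1" "kreweras_word n w"
  shows "window (nth w) 0 (3 * n)"
proof -
  have len: "length w = 3 * n" using assms by (simp add: kreweras_word_def)
  have w: "map (nth w) [0..<0 + 3 * n] = w" using map_nth[of w] len by simp
  have "height (nth w) 0 X i = int (count_list (take i w) A) - int (count_list (take i w) X)"
    if "X \<noteq> A" "i \<le> 3 * n" for X i
    using height_count[OF that, of "nth w" 0] unfolding w by simp
  then show ?thesis using assms len by (auto simp: window_def kreweras_word_def)
qed

theorem theorem1p2:
  fixes n :: nat and w :: "letter list"
  assumes "n \<ge> 1" and "kreweras_word n w"
  shows "(pro ^^ (3 * n)) w = map swap_BC w \<and> (pro ^^ (6 * n)) w = w"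
proof -
  define N where "N = 3 * n"
  interpret kreweras_evolution N "nth w"
    by unfold_locales (use kreweras_word_window[OF assms] in \<open>simp add: N_def\<close>)
  have len: "length w = N" using assms by (simp add: kreweras_word_def N_def)
  have w: "map (nth w) [0..<N] = w" using map_nth[of w] len by simp
  have "map (G (t + N)) [t + N..<t + N + N] = map swap_BC (map (G t) [t..<t + N])" for t
    by (rule nth_equalityI) (use G_add_N[of t "t + _"] in \<open>auto simp: ac_simps\<close>)
  then have *: "(pro ^^ (t + N)) w = map swap_BC ((pro ^^ t) w)" for t
    using pro_power[of t] pro_power[of "t + N"] w by simp
  have 1: "(pro ^^ N) w = map swap_BC w" using *[of 0] by simp
  have "map swap_BC (map swap_BC w) = w" by (simp add: comp_def)
  then have "(pro ^^ (N + N)) w = w" using *[of N] 1 by simp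
  moreover have "N + N = 6 * n" by (simp add: N_def)
  ultimately show ?thesis using 1 by (simp add: N_def)
qed

end
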